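(* Let $g\ge1$. Any element of $Sp_0$ is a product of elements of the following types: (1) symplectic permutations; (2) (if $g\ge2$) the matrix $B_1=\begin{pmatrix}A_1&0\\0&I_{2g-4}\end{pmatrix}$ with $$A_1=\begin{pmatrix}1&0&0&0\\0&1&0&1\\1&0&1&0\\0&0&0&1\end{pmatrix}.$$
   Context: $\mathbb{Z}_2^{2g}$ carries the standard symplectic form "$.$" with canonical basis $e_1,\dots,e_{2g}$ satisfying $e_{2i-1}.e_{2i}=e_{2i}.e_{2i-1}=1$ and all other products $0$. $Sp(\mathbb{Z}_2,2g)$ is its group of symplectic automorphisms (identified with matrices acting on column vectors). $\omega_0(x)=\sum_{k=1}^g x_{2k-1}x_{2k}$, and $Sp_0$ is the subgroup of those $f\in Sp(\mathbb{Z}_2,2g)$ with $\omega_0\circ f=\omega_0$. A symplectic permutation is an element of $Sp(\mathbb{Z}_2,2g)$ that permutes the canonical basis vectors $e_1,\dots,e_{2g}$. *)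

theory Defs
  imports "HOL-Library.Z2" "Jordan_Normal_Form.Matrix"
begin

(* Vectors and matrices are indexed from 0, so the canonical basis vector written e_i in
   one-based notation is unit_vec (2 * g) (i - 1), and the hyperbolic pairs are the
   coordinates (2k, 2k+1) for k < g. *)

definition symp_form :: "nat \<Rightarrow> bit vec \<Rightarrow> bit vec \<Rightarrow> bit" where
  "symp_form g x y = (\<Sum>k<g. x $ (2*k) * y $ (2*k+1) + x $ (2*k+1) * y $ (2*k))"

definition omega0 :: "nat \<Rightarrow> bit vec \<Rightarrow> bit" where
  "omega0 g x = (\<Sum>k<g. x $ (2*k) * x $ (2*k+1))"

definition Sp :: "nat \<Rightarrow> bit mat set" where
  "Sp g = {A \<in> carrier_mat (2*g) (2*g). invertible_mat A \<and>
     (\<forall>x \<in> carrier_vec (2*g). \<forall>y \<in> carrier_vec (2*g).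
        symp_form g (A *\<^sub>v x) (A *\<^sub>v y) = symp_form g x y)}"

definition Sp0 :: "nat \<Rightarrow> bit mat set" where
  "Sp0 g = {A \<in> Sp g. \<forall>x \<in> carrier_vec (2*g). omega0 g (A *\<^sub>v x) = omega0 g x}"

definition symplectic_permutation :: "nat \<Rightarrow> bit mat \<Rightarrow> bool" where
  "symplectic_permutation g A \<longleftrightarrow> A \<in> Sp g \<and>
     bij_betw (\<lambda>v. A *\<^sub>v v) (set (unit_vecs (2*g))) (set (unit_vecs (2*g)))"

definition A1 :: "bit mat" where
  "A1 = mat_of_rows_list 4
     [[1, 0, 0, 0],
      [0, 1, 0, 1],
      [1, 0, 1, 0],
      [0, 0, 0, 1]]"

(* Meaningful only for g >= 2, where the truncated subtraction is exact. *)
definition B1 :: "nat \<Rightarrow> bit mat" where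
  "B1 g = four_block_mat A1 (0\<^sub>m 4 (2*g - 4)) (0\<^sub>m (2*g - 4) 4) (1\<^sub>m (2*g - 4))"

(* The empty product is the identity matrix. *)
definition mat_prod :: "nat \<Rightarrow> bit mat list \<Rightarrow> bit mat" where
  "mat_prod n Bs = foldr (*) Bs (1\<^sub>m n)"

(* Being bilinear, symp_form g is determined by its values on the canonical basis. *)
lemma symp_form_unit_vec:
  assumes "i < 2*g" and "j < 2*g"
  shows "symp_form g (unit_vec (2*g) i) (unit_vec (2*g) j) =
    (if \<exists>k. {i, j} = {2*k, 2*k+1} then 1 else 0)"
proof -
  have div_eq: "(2*k = i \<and> 2*k+1 = j) \<or> (2*k+1 = i \<and> 2*k = j) \<Longrightarrow> k = i div 2" for k
    by auto
  have "symp_form g (unit_vec (2*g) i) (unit_vec (2*g) j) =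
      (\<Sum>k<g. if (2*k = i \<and> 2*k+1 = j) \<or> (2*k+1 = i \<and> 2*k = j) then 1 else 0)"
    unfolding symp_form_def using assms by (intro sum.cong) auto
  also have "\<dots> = (\<Sum>k<g. if k = i div 2 then
      (if (2*k = i \<and> 2*k+1 = j) \<or> (2*k+1 = i \<and> 2*k = j) then 1 else 0) else 0)"
    using div_eq by (intro sum.cong refl) (smt (verit))
  also have "\<dots> = (if (2*(i div 2) = i \<and> 2*(i div 2)+1 = j) \<or>
      (2*(i div 2)+1 = i \<and> 2*(i div 2) = j) then 1 else 0)"
    using assms by (subst sum.delta) auto
  also have "((2*(i div 2) = i \<and> 2*(i div 2)+1 = j) \<or>
      (2*(i div 2)+1 = i \<and> 2*(i div 2) = j)) \<longleftrightarrow> (\<exists>k. {i, j} = {2*k, 2*k+1})"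
    using div_eq by (simp add: doubleton_eq_iff) (metis (no_types, lifting))
  finally show ?thesis .
qed

end

theory Submission
  imports Defs
begin

text \<open>
  Call two basis indices partners when they form a hyperbolic pair. For indices \<open>i\<close>, \<open>j\<close> from
  different pairs, with partners \<open>i'\<close>, \<open>j'\<close>, the Siegel transformation \<open>siegel_mat g i j\<close> sends
  \<open>e_i'\<close> to \<open>e_i' + e_j\<close> and \<open>e_j'\<close> to \<open>e_j' + e_i\<close> and fixes the other basis vectors. The matrix
  \<open>B1 g\<close> is the one with \<open>i = 1\<close>, \<open>j = 2\<close>. Conjugating it by permutations of the basis that respect
  the pairs produces every Siegel transformation (\<open>siegel_mat_generated\<close>), so all of these are
  products of the given generators.

  With them an isometry of \<open>omega0\<close> is reduced to the identity one hyperbolic pair at a time, as in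
  Witt's theorem. Suppose the isometry \<open>A\<close> fixes the vectors of the first \<open>k\<close> pairs. Then
  \<open>v = A e_2k\<close> is a nonzero singular vector orthogonal to these pairs, hence supported on the
  remaining coordinates. A permutation puts a one at coordinate \<open>2k+1\<close> of \<open>v\<close>; adding \<open>e_j\<close> by the
  Siegel transformations with \<open>i = 2k\<close> then clears every coordinate outside the pair \<open>k\<close>, and
  singularity clears coordinate \<open>2k\<close> as well (\<open>clear_to_odd_unit\<close>). A final flip of the pair
  \<open>k\<close> moves \<open>v\<close> back to \<open>e_2k\<close> (\<open>move_to_even_unit\<close>). The image of \<open>e_(2k+1)\<close> now pairs to one with \<open>e_2k\<close>,
  so it has a one at coordinate \<open>2k+1\<close>, and the same clearing, which fixes \<open>e_2k\<close>, moves it to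
  \<open>e_(2k+1)\<close>. After \<open>g\<close> rounds the identity is left, and since all generators used are involutions,
  the multiplications can be undone.
\<close>

section \<open>Bits, matrices and hyperbolic partners\<close>

text \<open>Rewriting bit arithmetic to bitwise connectives would block ring reasoning.\<close>

declare add_bit_eq_xor [simp del] mult_bit_eq_and [simp del]

lemma bit_add_self [simp]: "a + a = (0::bit)" "a + (a + b) = (b::bit)"
  by (cases a; cases b; simp)+

text \<open>Identities between products of matrices are checked below on vectors, where the generators act
  by explicit formulas.\<close>

lemma mat_eqI_action:
  fixes A B :: "'a::semiring_1 mat"
  assumes A: "A \<in> carrier_mat n n" and B: "B \<in> carrier_mat n n"
    and eq: "\<And>j. j < n \<Longrightarrow> A *\<^sub>v unit_vec n j = B *\<^sub>v unit_vec n j"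
  shows "A = B"
proof (rule eq_matI)
  fix i j assume "i < dim_row B" "j < dim_col B"
  then have ij: "i < n" "j < n" using B by auto
  have "(A *\<^sub>v unit_vec n j) $ i = A $$ (i, j)" "(B *\<^sub>v unit_vec n j) $ i = B $$ (i, j)"
    using A B ij by (auto simp: scalar_prod_right_unit)
  then show "A $$ (i, j) = B $$ (i, j)" using eq[OF ij(2)] by simp
qed (use A B in auto)

definition partner :: "nat \<Rightarrow> nat" where
  "partner m = (if even m then m + 1 else m - 1)"

lemma partner_simps [simp]:
  "partner (partner m) = m" "partner m div 2 = m div 2" "partner m \<noteq> m"
  "partner m < 2 * g \<longleftrightarrow> m < 2 * g"
  "partner (2 * k) = 2 * k + 1" "partner (Suc (2 * k)) = 2 * k" "partner 0 = 1"
  by (auto simp: partner_def elim!: evenE oddE)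

lemma partner_eq_iff [simp]: "partner m = partner l \<longleftrightarrow> m = l"
  by (metis partner_simps(1))

lemma same_pair: "m div 2 = l div 2 \<longleftrightarrow> m = l \<or> m = partner l"
  by (auto simp: partner_def elim!: evenE oddE)

lemma symp_form_unit:
  assumes "m < 2 * g"
  shows "symp_form g x (unit_vec (2 * g) m) = x $ partner m"
proof -
  have "symp_form g x (unit_vec (2 * g) m) =
      (\<Sum>k<g. if k = m div 2 then x $ partner m else 0)"
    unfolding symp_form_def using assms
    by (intro sum.cong) (auto simp: partner_def)
  also have "\<dots> = x $ partner m"
    using assms by (subst sum.delta) auto
  finally show ?thesis .
qed

lemma omega0_add:
  assumes "x \<in> carrier_vec (2 * g)" "y \<in> carrier_vec (2 * g)"
  shows "omega0 g (x + y) = omega0 g x + omega0 g y + symp_form g x y"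
proof -
  have "omega0 g (x + y) = (\<Sum>k<g. x $ (2*k) * x $ (2*k+1) + y $ (2*k) * y $ (2*k+1) +
      (x $ (2*k) * y $ (2*k+1) + x $ (2*k+1) * y $ (2*k)))"
    unfolding omega0_def using assms
    by (intro sum.cong) (auto simp: algebra_simps)
  then show ?thesis
    unfolding omega0_def symp_form_def by (simp add: sum.distrib)
qed

section \<open>Isometries of the quadratic form\<close>

text \<open>
  Preservation of \<open>omega0\<close> entails preservation of its polarization \<open>symp_form\<close>, and invertibility
  in turn because that form is nondegenerate; so these are exactly the elements of \<open>Sp0 g\<close>.
\<close>

definition isometry :: "nat \<Rightarrow> bit mat \<Rightarrow> bool" where
  "isometry g A \<longleftrightarrow> A \<in> carrier_mat (2 * g) (2 * g) \<and>
     (\<forall>x \<in> carrier_vec (2 * g). omega0 g (A *\<^sub>v x) = omega0 g x)"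

lemma isometry_carrier: "isometry g A \<Longrightarrow> A \<in> carrier_mat (2 * g) (2 * g)"
  by (simp add: isometry_def)

lemma isometry_omega0:
  "isometry g A \<Longrightarrow> x \<in> carrier_vec (2 * g) \<Longrightarrow> omega0 g (A *\<^sub>v x) = omega0 g x"
  by (simp add: isometry_def)

lemma isometry_symp_form:
  assumes A: "isometry g A"
    and x: "x \<in> carrier_vec (2 * g)" and y: "y \<in> carrier_vec (2 * g)"
  shows "symp_form g (A *\<^sub>v x) (A *\<^sub>v y) = symp_form g x y"
proof -
  note C = isometry_carrier[OF A]
  have "omega0 g (A *\<^sub>v x) + omega0 g (A *\<^sub>v y) + symp_form g (A *\<^sub>v x) (A *\<^sub>v y) =
      omega0 g (A *\<^sub>v x + A *\<^sub>v y)"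
    using C x y by (simp add: omega0_add)
  also have "\<dots> = omega0 g (A *\<^sub>v (x + y))"
    using C x y by (simp add: mult_add_distrib_mat_vec)
  also have "\<dots> = omega0 g x + omega0 g y + symp_form g x y"
    using A x y by (simp add: isometry_omega0 omega0_add)
  finally show ?thesis
    using A x y by (simp add: isometry_omega0)
qed

lemma isometry_one: "isometry g (1\<^sub>m (2 * g))"
  by (simp add: isometry_def)

lemma isometry_mult:
  assumes "isometry g A" "isometry g B"
  shows "isometry g (A * B)"
  unfolding isometry_def
proof (intro conjI ballI)
  fix x :: "bit vec" assume "x \<in> carrier_vec (2 * g)"
  then show "omega0 g (A * B *\<^sub>v x) = omega0 g x"
    using assms isometry_carrier[of g A] isometry_carrier[of g B]
    by (simp add: isometry_omega0 mult_mat_vec_carrier)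
qed (rule mult_carrier_mat[OF isometry_carrier isometry_carrier, OF assms])

section \<open>Permutations of the basis that respect hyperbolic pairs\<close>

text \<open>Only involutive permutations are admitted, which makes every generator its own inverse; flips
  within a pair and exchanges of two pairs already suffice.\<close>

definition pair_involution :: "nat \<Rightarrow> (nat \<Rightarrow> nat) \<Rightarrow> bool" where
  "pair_involution g \<rho> \<longleftrightarrow>
     (\<forall>m < 2 * g. \<rho> m < 2 * g \<and> \<rho> (\<rho> m) = m \<and> \<rho> (partner m) = partner (\<rho> m))"

lemma pair_involutionD:
  assumes "pair_involution g \<rho>" "m < 2 * g"
  shows "\<rho> m < 2 * g" "\<rho> (\<rho> m) = m" "\<rho> (partner m) = partner (\<rho> m)"
  using assms unfolding pair_involution_def by blast+

lemma pair_involution_eq_iff: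
  assumes "pair_involution g \<rho>" "r < 2 * g" "m < 2 * g"
  shows "\<rho> r = m \<longleftrightarrow> r = \<rho> m"
  using pair_involutionD(2)[OF assms(1)] assms(2,3) by metis

definition perm_mat :: "nat \<Rightarrow> (nat \<Rightarrow> nat) \<Rightarrow> bit mat" where
  "perm_mat g \<rho> = mat (2 * g) (2 * g) (\<lambda>(r, c). if c = \<rho> r then 1 else 0)"

lemma perm_mat_carrier [simp]: "perm_mat g \<rho> \<in> carrier_mat (2 * g) (2 * g)"
  by (simp add: perm_mat_def)

lemma perm_mat_action:
  assumes "pair_involution g \<rho>" "x \<in> carrier_vec (2 * g)" "r < 2 * g"
  shows "(perm_mat g \<rho> *\<^sub>v x) $ r = x $ \<rho> r"
proof -
  have "(perm_mat g \<rho> *\<^sub>v x) $ r = (\<Sum>c = 0..<2*g. (if c = \<rho> r then 1 else 0) * x $ c)"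
    using assms by (simp add: perm_mat_def scalar_prod_def)
  also have "\<dots> = (\<Sum>c = 0..<2*g. if c = \<rho> r then x $ c else 0)"
    by (intro sum.cong) auto
  also have "\<dots> = x $ \<rho> r"
    using assms by (subst sum.delta) (auto simp: pair_involution_def)
  finally show ?thesis .
qed

lemma perm_mat_unit:
  assumes "pair_involution g \<rho>" "m < 2 * g"
  shows "perm_mat g \<rho> *\<^sub>v unit_vec (2 * g) m = unit_vec (2 * g) (\<rho> m)"
proof (rule eq_vecI)
  fix r assume "r < dim_vec (unit_vec (2 * g) (\<rho> m) :: bit vec)"
  then have r: "r < 2 * g" by simp
  then show "(perm_mat g \<rho> *\<^sub>v unit_vec (2 * g) m) $ r = unit_vec (2 * g) (\<rho> m) $ r"
    using assms pair_involutionD(1)[OF assms(1)] pair_involution_eq_iff[OF assms(1) r assms(2)]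
    by (simp add: perm_mat_action)
qed (simp add: perm_mat_def)

lemma perm_mat_square:
  assumes "pair_involution g \<rho>"
  shows "perm_mat g \<rho> * perm_mat g \<rho> = 1\<^sub>m (2 * g)"
proof (rule mat_eqI_action)
  fix j assume "j < 2 * g"
  then show "perm_mat g \<rho> * perm_mat g \<rho> *\<^sub>v unit_vec (2 * g) j =
      1\<^sub>m (2 * g) *\<^sub>v unit_vec (2 * g) j"
    using assms by (simp add: assoc_mult_mat_vec[of _ "2*g" "2*g" _ "2*g"] perm_mat_unit
        pair_involution_def)
qed (rule mult_carrier_mat[OF perm_mat_carrier perm_mat_carrier], simp)

text \<open>The permutation induces a permutation of the \<open>g\<close> pairs, which only reorders the sum \<open>omega0\<close>;
  exchanging the two members of a pair does not alter their product.\<close>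

lemma perm_mat_isometry:
  assumes \<rho>: "pair_involution g \<rho>"
  shows "isometry g (perm_mat g \<rho>)"
  unfolding isometry_def
proof (intro conjI ballI)
  fix x :: "bit vec" assume x: "x \<in> carrier_vec (2 * g)"
  define h where "h k = \<rho> (2 * k) div 2" for k
  have \<rho>_even: "\<rho> (2 * k) < 2 * g" "\<rho> (2 * k + 1) = partner (\<rho> (2 * k))" if "k < g" for k
  proof -
    have "2 * k < 2 * g" using that by simp
    then have "\<rho> (2 * k) < 2 * g" "\<rho> (partner (2 * k)) = partner (\<rho> (2 * k))"
      using \<rho> unfolding pair_involution_def by blast+
    then show "\<rho> (2 * k) < 2 * g" "\<rho> (2 * k + 1) = partner (\<rho> (2 * k))" by simp_all
  qed
  \<comment> \<open>\<open>h\<close> is the induced map on pairs; if two pairs had the same image, \<open>\<rho>\<close> would send the even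
    member of one to the same index as a member of the other.\<close>
  have inj: "inj_on h {..<g}"
  proof (rule inj_onI)
    fix k l assume kl: "k \<in> {..<g}" "l \<in> {..<g}" and "h k = h l"
    then consider "\<rho> (2 * k) = \<rho> (2 * l)" | "\<rho> (2 * k) = \<rho> (2 * l + 1)"
      using \<rho>_even(2)[of l] by (auto simp: h_def same_pair)
    then show "k = l"
    proof cases
      case 1
      have "\<rho> (\<rho> (2 * k)) = 2 * k" "\<rho> (\<rho> (2 * l)) = 2 * l"
        using \<rho> kl by (auto simp: pair_involution_def)
      then have "2 * k = 2 * l" using 1 by metis
      then show ?thesis by simp
    next
      case 2
      have "\<rho> (\<rho> (2 * k)) = 2 * k" "\<rho> (\<rho> (2 * l + 1)) = 2 * l + 1"
        using \<rho> kl by (auto simp: pair_involution_def)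
      then have "2 * k = 2 * l + 1" using 2 by metis
      then show ?thesis by presburger
    qed
  qed
  have bij: "bij_betw h {..<g} {..<g}"
    using inj \<rho>_even(1) by (intro bij_betw_imageI endo_inj_surj) (auto simp: h_def less_mult_imp_div_less mult.commute)
  have "omega0 g (perm_mat g \<rho> *\<^sub>v x) = (\<Sum>k<g. x $ \<rho> (2 * k) * x $ partner (\<rho> (2 * k)))"
    unfolding omega0_def using \<rho>_even
    by (intro sum.cong) (auto simp: perm_mat_action[OF \<rho> x])
  also have "\<dots> = (\<Sum>k<g. x $ (2 * h k) * x $ (2 * h k + 1))"
  proof (intro sum.cong refl)
    fix k
    have "\<rho> (2 * k) = 2 * h k \<or> \<rho> (2 * k) = 2 * h k + 1" unfolding h_def by presburger
    then show "x $ \<rho> (2 * k) * x $ partner (\<rho> (2 * k)) = x $ (2 * h k) * x $ (2 * h k + 1)"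
      by (elim disjE) (simp_all add: mult.commute[of "x $ (2 * h k)"])
  qed
  also have "\<dots> = omega0 g x"
    unfolding omega0_def by (rule sum.reindex_bij_betw[OF bij])
  finally show "omega0 g (perm_mat g \<rho> *\<^sub>v x) = omega0 g x" .
qed simp

lemma perm_mat_symplectic_permutation:
  assumes \<rho>: "pair_involution g \<rho>"
  shows "symplectic_permutation g (perm_mat g \<rho>)"
proof -
  have "inverts_mat (perm_mat g \<rho>) (perm_mat g \<rho>)"
    using perm_mat_square[OF \<rho>] by (simp add: inverts_mat_def perm_mat_def)
  then have "invertible_mat (perm_mat g \<rho>)"
    by (auto simp: invertible_mat_def perm_mat_def)
  then have "perm_mat g \<rho> \<in> Sp g"
    using isometry_symp_form[OF perm_mat_isometry[OF \<rho>]] by (auto simp: Sp_def)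
  moreover have "bij_betw (\<lambda>v. perm_mat g \<rho> *\<^sub>v v)
      (set (unit_vecs (2 * g))) (set (unit_vecs (2 * g)))"
    using \<rho> by (intro bij_betw_byWitness[where f' = "\<lambda>v. perm_mat g \<rho> *\<^sub>v v"])
      (auto simp: unit_vecs_def perm_mat_unit pair_involution_def)
  ultimately show ?thesis by (simp add: symplectic_permutation_def)
qed

definition swap_pairs :: "nat \<Rightarrow> nat \<Rightarrow> nat \<Rightarrow> nat" where
  "swap_pairs a b m = 2 * (if m div 2 = a then b else if m div 2 = b then a else m div 2) + m mod 2"

definition flip_pair :: "nat \<Rightarrow> nat \<Rightarrow> nat" where
  "flip_pair a m = (if m div 2 = a then partner m else m)"

lemma swap_pairs_involution:
  assumes "a < g" "b < g"
  shows "pair_involution g (swap_pairs a b)"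
proof -
  define \<tau> where "\<tau> q = (if q = a then b else if q = b then a else q)" for q
  have \<tau>: "\<tau> (\<tau> q) = q" "q < g \<Longrightarrow> \<tau> q < g" for q
    using assms by (simp_all add: \<tau>_def)
  have swap: "swap_pairs a b m = 2 * \<tau> (m div 2) + m mod 2" for m
    by (simp only: swap_pairs_def \<tau>_def)
  have "swap_pairs a b m < 2 * g" if "m < 2 * g" for m
  proof -
    have "\<tau> (m div 2) < g" using that by (intro \<tau>(2)) linarith
    then show ?thesis unfolding swap by linarith
  qed
  moreover have "swap_pairs a b (swap_pairs a b m) = m" for m
    unfolding swap by (simp add: \<tau>)
  moreover have "swap_pairs a b (partner m) = partner (swap_pairs a b m)" for m
  proof (cases "even m")
    case True
    then have "partner m mod 2 = 1" "m mod 2 = 0" unfolding partner_def by presburger+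
    then show ?thesis by (simp add: swap)
  next
    case False
    then have "partner m mod 2 = 0" "m mod 2 = 1" unfolding partner_def by presburger+
    then show ?thesis by (simp add: swap)
  qed
  ultimately show ?thesis by (simp add: pair_involution_def)
qed

lemma flip_pair_involution: "pair_involution g (flip_pair a)"
  by (simp add: pair_involution_def flip_pair_def)

section \<open>Siegel transformations\<close>

text \<open>
  This is the map \<open>x \<mapsto> x + (e_i . x) e_j + (e_j . x) e_i\<close>, where \<open>e_i . x\<close> is the coordinate of \<open>x\<close>
  at the partner of \<open>i\<close>. It is an isometry when \<open>i\<close> and \<open>j\<close> lie in different pairs.
\<close>

definition siegel_mat :: "nat \<Rightarrow> nat \<Rightarrow> nat \<Rightarrow> bit mat" where
  "siegel_mat g i j = mat (2 * g) (2 * g) (\<lambda>(r, c). (if c = r then 1 else 0) +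
     (if c = partner i then if r = j then 1 else 0 else 0) +
     (if c = partner j then if r = i then 1 else 0 else 0))"

lemma siegel_mat_carrier [simp]: "siegel_mat g i j \<in> carrier_mat (2 * g) (2 * g)"
  by (simp add: siegel_mat_def)

lemma siegel_mat_action:
  assumes "i < 2 * g" "j < 2 * g" "x \<in> carrier_vec (2 * g)" "r < 2 * g"
  shows "(siegel_mat g i j *\<^sub>v x) $ r = x $ r +
    (if r = j then x $ partner i else 0) + (if r = i then x $ partner j else 0)"
proof -
  have "(siegel_mat g i j *\<^sub>v x) $ r = (\<Sum>c = 0..<2*g. (if c = r then x $ c else 0) +
     (if c = partner i then if r = j then x $ c else 0 else 0) +
     (if c = partner j then if r = i then x $ c else 0 else 0))"
    using assms unfolding siegel_mat_def scalar_prod_def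
    by (auto simp: scalar_prod_def algebra_simps intro!: sum.cong)
  also have "\<dots> = x $ r +
    (if r = j then x $ partner i else 0) + (if r = i then x $ partner j else 0)"
    using assms by (simp add: sum.distrib sum.delta)
  finally show ?thesis .
qed

lemma B1_eq_siegel_mat:
  assumes "g \<ge> 2"
  shows "B1 g = siegel_mat g 1 2"
proof (rule eq_matI)
  have A1: "A1 \<in> carrier_mat 4 4" unfolding A1_def mat_of_rows_list_def by (intro carrier_matI) simp_all
  show dims: "dim_row (B1 g) = dim_row (siegel_mat g 1 2)" "dim_col (B1 g) = dim_col (siegel_mat g 1 2)"
    using assms A1 by (auto simp: B1_def siegel_mat_def)
  fix r c assume "r < dim_row (siegel_mat g 1 2)" "c < dim_col (siegel_mat g 1 2)"
  then have rc: "r < 2 * g" "c < 2 * g" by (simp_all add: siegel_mat_def)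
  have B: "B1 g $$ (r, c) = (if r < 4 then if c < 4 then A1 $$ (r, c) else 0
      else if c < 4 then 0 else if r = c then 1 else 0)"
    using rc A1 assms by (auto simp: B1_def)
  have S: "siegel_mat g 1 2 $$ (r, c) = (if c = r then 1 else 0) +
      (if c = 0 then if r = 2 then 1 else 0 else 0) + (if c = 3 then if r = 1 then 1 else 0 else 0)"
    using rc by (simp add: siegel_mat_def partner_def)
  show "B1 g $$ (r, c) = siegel_mat g 1 2 $$ (r, c)"
  proof (cases "r < 4 \<and> c < 4")
    case True
    then have "r \<in> {0, 1, 2, 3}" "c \<in> {0, 1, 2, 3}" by auto
    then show ?thesis
      unfolding B S by (auto simp: A1_def mat_of_rows_list_def)
  next
    case False
    then show ?thesis
      unfolding B S by auto
  qed
qed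

text \<open>Only the first two pairs are affected: the contributions \<open>x$0 * x$3\<close> from each of them cancel.\<close>

lemma B1_isometry:
  assumes g: "g \<ge> 2"
  shows "isometry g (B1 g)"
  unfolding isometry_def
proof (intro conjI ballI)
  show "B1 g \<in> carrier_mat (2 * g) (2 * g)" by (simp only: B1_eq_siegel_mat[OF g] siegel_mat_carrier)
  fix x :: "bit vec" assume x: "x \<in> carrier_vec (2 * g)"
  define y where "y = B1 g *\<^sub>v x"
  have split: "{..<g} = insert 0 (insert 1 {2..<g})" using g by auto
  have act: "y $ r = x $ r + (if r = 2 then x $ 0 else 0) + (if r = 1 then x $ 3 else 0)"
    if "r < 2 * g" for r
    using siegel_mat_action[of 1 g 2 x r] g x that
    by (simp add: y_def B1_eq_siegel_mat[OF g] partner_def)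
  have rest: "(\<Sum>k\<in>{2..<g}. y $ (2*k) * y $ (2*k+1)) = (\<Sum>k\<in>{2..<g}. x $ (2*k) * x $ (2*k+1))"
  proof (intro sum.cong refl)
    fix k assume k: "k \<in> {2..<g}"
    have "y $ (2*k) = x $ (2*k)" "y $ (2*k+1) = x $ (2*k+1)"
      using k act[of "2*k"] act[of "2*k+1"] by simp_all
    then show "y $ (2*k) * y $ (2*k+1) = x $ (2*k) * x $ (2*k+1)" by (simp only:)
  qed
  have low: "y $ 0 = x $ 0" "y $ 1 = x $ 1 + x $ 3" "y $ 2 = x $ 2 + x $ 0" "y $ 3 = x $ 3"
    using g act[of 0] act[of 1] act[of 2] act[of 3] by simp_all
  have omega0_split:
    "omega0 g z = z $ 0 * z $ 1 + (z $ 2 * z $ 3 + (\<Sum>k\<in>{2..<g}. z $ (2*k) * z $ (2*k+1)))" for z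
    unfolding omega0_def split by (simp add: eval_nat_numeral)
  have "a * (b + d) + ((c + a) * d + s) = a * b + (c * d + s)" for a b c d s :: bit
    by (cases a; cases b; cases c; cases d; simp)
  then show "omega0 g (B1 g *\<^sub>v x) = omega0 g x"
    unfolding y_def[symmetric] omega0_split rest low .
qed

section \<open>The group generated by pair permutations and \<open>B1\<close>\<close>

inductive_set generated :: "nat \<Rightarrow> bit mat set" for g where
  one: "1\<^sub>m (2 * g) \<in> generated g"
| perm: "pair_involution g \<rho> \<Longrightarrow> M \<in> generated g \<Longrightarrow> perm_mat g \<rho> * M \<in> generated g"
| B1: "g \<ge> 2 \<Longrightarrow> M \<in> generated g \<Longrightarrow> B1 g * M \<in> generated g"

lemma generated_isometry: "M \<in> generated g \<Longrightarrow> isometry g M"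
  by (induction rule: generated.induct)
    (auto intro: isometry_one isometry_mult perm_mat_isometry B1_isometry)

lemma generated_carrier: "M \<in> generated g \<Longrightarrow> M \<in> carrier_mat (2 * g) (2 * g)"
  by (rule isometry_carrier[OF generated_isometry])

lemma generated_mult:
  assumes "M \<in> generated g" "N \<in> generated g"
  shows "M * N \<in> generated g"
  using assms(1)
proof (induction rule: generated.induct)
  case one
  then show ?case using assms(2) generated_carrier[OF assms(2)] by simp
next
  case (perm \<rho> M)
  then show ?case
    using generated.perm[OF perm(1) perm.IH] generated_carrier[OF perm(2)]
      generated_carrier[OF assms(2)]
    by (simp add: assoc_mult_mat[of _ "2*g" "2*g" _ "2*g" _ "2*g"])
next
  case (B1 M)
  then show ?case
    using generated.B1[OF B1(1) B1.IH] generated_carrier[OF B1(2)]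
      generated_carrier[OF assms(2)] isometry_carrier[OF B1_isometry[OF B1(1)]]
    by (simp add: assoc_mult_mat[of _ "2*g" "2*g" _ "2*g" _ "2*g"])
qed

lemma generated_perm_mat: "pair_involution g \<rho> \<Longrightarrow> perm_mat g \<rho> \<in> generated g"
  using generated.perm[OF _ generated.one, of g \<rho>] right_mult_one_mat[OF perm_mat_carrier] by metis

lemma generated_B1: "g \<ge> 2 \<Longrightarrow> B1 g \<in> generated g"
  using generated.B1[OF _ generated.one] isometry_carrier[OF B1_isometry] by fastforce

lemma siegel_mat_square:
  assumes ij: "i < 2 * g" "j < 2 * g" "i div 2 \<noteq> j div 2"
  shows "siegel_mat g i j * siegel_mat g i j = 1\<^sub>m (2 * g)"
proof (rule mat_eqI_action)
  fix m assume "m < 2 * g"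
  define x :: "bit vec" where "x = unit_vec (2 * g) m"
  have x: "x \<in> carrier_vec (2 * g)" by (simp add: x_def)
  have ne: "partner i \<noteq> j" "partner j \<noteq> i" "i \<noteq> j" "partner i \<noteq> i" "partner j \<noteq> j"
    using ij(3) by (auto simp: same_pair)
  define y where "y = siegel_mat g i j *\<^sub>v x"
  have y: "y \<in> carrier_vec (2 * g)" unfolding y_def by (rule mult_mat_vec_carrier[OF siegel_mat_carrier x])
  have act: "y $ r = x $ r + (if r = j then x $ partner i else 0) + (if r = i then x $ partner j else 0)"
    if "r < 2 * g" for r
    unfolding y_def using ij(1,2) x that by (rule siegel_mat_action)
  have "siegel_mat g i j *\<^sub>v y = x"
  proof (rule eq_vecI)
    fix r assume "r < dim_vec x"
    then have r: "r < 2 * g" using x by simp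
    have "y $ partner i = x $ partner i" "y $ partner j = x $ partner j"
      using act[of "partner i"] act[of "partner j"] ij ne by simp_all
    then show "(siegel_mat g i j *\<^sub>v y) $ r = x $ r"
      unfolding siegel_mat_action[OF ij(1,2) y r] act[OF r] using ne(3) by simp
  qed (use x in \<open>simp add: siegel_mat_def\<close>)
  then show "siegel_mat g i j * siegel_mat g i j *\<^sub>v unit_vec (2 * g) m =
      1\<^sub>m (2 * g) *\<^sub>v unit_vec (2 * g) m"
    using x by (simp add: assoc_mult_mat_vec[of _ "2*g" "2*g" _ "2*g"] x_def y_def)
qed (rule mult_carrier_mat[OF siegel_mat_carrier siegel_mat_carrier], simp)

lemma involution_mult_cancel:
  fixes X M A :: "'a::semiring_1 mat"
  assumes X: "X \<in> carrier_mat n n" "X * X = 1\<^sub>m n"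
    and M: "M \<in> carrier_mat n n" and A: "A \<in> carrier_mat n n"
  shows "X * (X * M * A) = M * A"
proof -
  have MA: "M * A \<in> carrier_mat n n" using M A by simp
  have "X * (X * M * A) = X * (X * (M * A))"
    using X M A by (simp add: assoc_mult_mat[of _ n n _ n _ n])
  also have "\<dots> = X * X * (M * A)"
    by (rule assoc_mult_mat[OF X(1) X(1) MA, symmetric])
  also have "\<dots> = M * A" unfolding X(2) by (rule left_mult_one_mat[OF MA])
  finally show ?thesis .
qed

text \<open>Every generator is an involution, so multiplying by it once more removes it. This stands in for
  closure under inverses.\<close>

lemma generated_left_cancel:
  assumes "M \<in> generated g" "A \<in> carrier_mat (2 * g) (2 * g)" "M * A \<in> generated g"
  shows "A \<in> generated g"
  using assms
proof (induction rule: generated.induct)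
  case one
  then show ?case by simp
next
  case (perm \<rho> M)
  have "M * A \<in> generated g"
    using generated.perm[OF perm(1) perm.prems(2)]
      involution_mult_cancel[OF perm_mat_carrier perm_mat_square[OF perm(1)]
        generated_carrier[OF perm(2)] perm.prems(1)]
    by simp
  then show ?case using perm.IH perm.prems by simp
next
  case (B1 M)
  have "B1 g * B1 g = 1\<^sub>m (2 * g)"
    using siegel_mat_square[of 1 g 2] B1(1) by (simp add: B1_eq_siegel_mat)
  then have "M * A \<in> generated g"
    using generated.B1[OF B1(1) B1.prems(2)]
      involution_mult_cancel[OF isometry_carrier[OF B1_isometry[OF B1(1)]] _
        generated_carrier[OF B1(2)] B1.prems(1)]
    by simp
  then show ?case using B1.IH B1.prems by simp
qed

lemma siegel_mat_conjugate:
  assumes \<rho>: "pair_involution g \<rho>" and ij: "i < 2 * g" "j < 2 * g"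
  shows "perm_mat g \<rho> * (siegel_mat g i j * perm_mat g \<rho>) = siegel_mat g (\<rho> i) (\<rho> j)"
proof (rule mat_eqI_action)
  fix m assume "m < 2 * g"
  define x :: "bit vec" where "x = unit_vec (2 * g) m"
  have x: "x \<in> carrier_vec (2 * g)" by (simp add: x_def)
  have "perm_mat g \<rho> *\<^sub>v (siegel_mat g i j *\<^sub>v (perm_mat g \<rho> *\<^sub>v x)) =
      siegel_mat g (\<rho> i) (\<rho> j) *\<^sub>v x"
  proof (rule eq_vecI)
    fix r assume "r < dim_vec (siegel_mat g (\<rho> i) (\<rho> j) *\<^sub>v x)"
    then have r: "r < 2 * g" by (simp add: siegel_mat_def)
    note D = pair_involutionD[OF \<rho>] and iff = pair_involution_eq_iff[OF \<rho> r]
    define y where "y = perm_mat g \<rho> *\<^sub>v x"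
    have y: "y \<in> carrier_vec (2 * g)" unfolding y_def by (rule mult_mat_vec_carrier[OF perm_mat_carrier x])
    define z where "z = siegel_mat g i j *\<^sub>v y"
    have z: "z \<in> carrier_vec (2 * g)" unfolding z_def by (rule mult_mat_vec_carrier[OF siegel_mat_carrier y])
    have act: "(perm_mat g \<rho> *\<^sub>v z) $ r = z $ \<rho> r" "z $ \<rho> r = y $ \<rho> r +
        (if \<rho> r = j then y $ partner i else 0) + (if \<rho> r = i then y $ partner j else 0)"
      "y $ \<rho> r = x $ r" "y $ partner i = x $ partner (\<rho> i)" "y $ partner j = x $ partner (\<rho> j)"
      using D r ij
      by (simp_all add: perm_mat_action[OF \<rho> z] perm_mat_action[OF \<rho> x, folded y_def]
        siegel_mat_action[OF ij y, folded z_def])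
    show "(perm_mat g \<rho> *\<^sub>v (siegel_mat g i j *\<^sub>v (perm_mat g \<rho> *\<^sub>v x))) $ r =
        (siegel_mat g (\<rho> i) (\<rho> j) *\<^sub>v x) $ r"
      unfolding y_def[symmetric] z_def[symmetric] act iff[OF ij(1)] iff[OF ij(2)]
      using D ij r by (simp add: siegel_mat_action[OF _ _ x])
  qed (simp add: siegel_mat_def perm_mat_def)
  then show "perm_mat g \<rho> * (siegel_mat g i j * perm_mat g \<rho>) *\<^sub>v unit_vec (2 * g) m =
      siegel_mat g (\<rho> i) (\<rho> j) *\<^sub>v unit_vec (2 * g) m"
    using x assoc_mult_mat_vec[OF perm_mat_carrier mult_carrier_mat[OF siegel_mat_carrier perm_mat_carrier] x]
      assoc_mult_mat_vec[OF siegel_mat_carrier perm_mat_carrier x]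
    by (simp add: x_def)
qed (rule mult_carrier_mat[OF perm_mat_carrier
      mult_carrier_mat[OF siegel_mat_carrier perm_mat_carrier]], simp)

text \<open>
  Pair permutations act transitively on pairs of indices from different hyperbolic pairs. Starting
  from \<open>(1, 2)\<close>, flips of the pairs 1 and 0 reach the indices 0 to 3, an exchange of pair 1 with the
  pair of \<open>q\<close> reaches every second index, and an exchange of pair 0 with the pair of \<open>i\<close> every first
  index.
\<close>

lemma siegel_mat_generated:
  assumes ij: "i < 2 * g" "j < 2 * g" "i div 2 \<noteq> j div 2"
  shows "siegel_mat g i j \<in> generated g"
proof -
  have conj: "siegel_mat g (\<rho> p) (\<rho> q) \<in> generated g"
    if "siegel_mat g p q \<in> generated g" "pair_involution g \<rho>" "p < 2 * g" "q < 2 * g" for \<rho> p q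
    unfolding siegel_mat_conjugate[OF that(2-4), symmetric]
    by (intro generated_mult generated_perm_mat that)
  have g: "g \<ge> 2" using ij by linarith
  have base: "siegel_mat g 1 2 \<in> generated g"
    using generated_B1[OF g] B1_eq_siegel_mat[OF g] by simp
  have odd2: "siegel_mat g 1 q \<in> generated g" if "q \<in> {2, 3}" for q
    using conj[OF base flip_pair_involution[of g 1]] base that g
    by (auto simp: flip_pair_def partner_def)
  have first: "siegel_mat g p q \<in> generated g" if "p \<in> {0, 1}" "q \<in> {2, 3}" for p q
    using conj[OF odd2[OF that(2)] flip_pair_involution[of g 0]] odd2[OF that(2)] that g
    by (auto simp: flip_pair_def partner_def)
  have pair0: "siegel_mat g p q \<in> generated g" if "p \<in> {0, 1}" "q < 2 * g" "q \<noteq> 0" "q \<noteq> 1" for p q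
  proof -
    define q' where "q' = 2 + q mod 2"
    have "swap_pairs 1 (q div 2) p = p" "swap_pairs 1 (q div 2) q' = q"
      using that by (auto simp: swap_pairs_def q'_def)
    moreover have "pair_involution g (swap_pairs 1 (q div 2))"
      using that g by (intro swap_pairs_involution) auto
    moreover have "q' \<in> {2, 3}" unfolding q'_def by auto
    moreover have "q' < 2 + 2" unfolding q'_def by simp
    then have "p < 2 * g" "q' < 2 * g" using that(1) g by auto
    ultimately show ?thesis
      using conj[OF first[OF that(1)], of q' "swap_pairs 1 (q div 2)"] by simp
  qed
  define \<sigma> where "\<sigma> = swap_pairs 0 (i div 2)"
  have \<sigma>: "pair_involution g \<sigma>"
    using ij unfolding \<sigma>_def by (intro swap_pairs_involution) auto
  have "\<sigma> i \<in> {0, 1}" "\<sigma> j \<noteq> 0" "\<sigma> j \<noteq> 1"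
    using ij(3) by (auto simp: \<sigma>_def swap_pairs_def)
  then have "siegel_mat g (\<sigma> i) (\<sigma> j) \<in> generated g"
    by (intro pair0 pair_involutionD(1)[OF \<sigma> ij(2)])
  from conj[OF this \<sigma> pair_involutionD(1)[OF \<sigma> ij(1)] pair_involutionD(1)[OF \<sigma> ij(2)]]
  show ?thesis by (simp only: pair_involutionD(2)[OF \<sigma> ij(1)] pair_involutionD(2)[OF \<sigma> ij(2)])
qed

section \<open>Moving singular vectors to basis vectors\<close>

text \<open>
  Because \<open>w\<close> has a one at coordinate \<open>2k+1\<close>, \<open>siegel_mat g (2*k) j\<close> flips coordinate \<open>j\<close> of \<open>w\<close>, and
  otherwise changes only coordinate \<open>2k\<close>. So each coordinate above the pair \<open>k\<close> can be cleared, and the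
  number of ones there is the induction measure. The value at coordinate \<open>2k\<close> need not be tracked:
  at the end it equals \<open>omega0 g w\<close>.
\<close>

lemma clear_to_odd_unit:
  assumes k: "k < g"
    and "w \<in> carrier_vec (2 * g)" "w $ (2 * k + 1) = 1" "omega0 g w = 0"
    and "\<And>m. m < 2 * k \<Longrightarrow> w $ m = 0"
  shows "\<exists>M \<in> generated g. M *\<^sub>v w = unit_vec (2 * g) (2 * k + 1) \<and>
    (\<forall>m \<le> 2 * k. M *\<^sub>v unit_vec (2 * g) m = unit_vec (2 * g) m)"
  using assms(2-5)
proof (induction "card {j. 2 * k + 2 \<le> j \<and> j < 2 * g \<and> w $ j = 1}" arbitrary: w rule: less_induct)
  case less
  note w = less.prems(1) and odd1 = less.prems(2) and low = less.prems(4)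
  define S where "S x = {j. 2 * k + 2 \<le> j \<and> j < 2 * g \<and> x $ j = 1}" for x :: "bit vec"
  have fin: "finite (S x)" for x by (rule finite_subset[of _ "{..<2 * g}"]) (auto simp: S_def)
  show ?case
  proof (cases "S w = {}")
    case True
    then have high: "w $ m = 0" if "2 * k + 2 \<le> m" "m < 2 * g" for m
      using that by (auto simp: S_def)
    have "omega0 g w = (\<Sum>l<g. if l = k then w $ (2 * k) else 0)"
      unfolding omega0_def
    proof (intro sum.cong refl)
      fix l assume "l \<in> {..<g}"
      then show "w $ (2 * l) * w $ (2 * l + 1) = (if l = k then w $ (2 * k) else 0)"
        using odd1 low[of "2 * l"] high[of "2 * l"] by (cases l k rule: linorder_cases) auto
    qed
    also have "\<dots> = w $ (2 * k)" using k by simp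
    finally have even0: "w $ (2 * k) = 0" using less.prems(3) by simp
    have "w = unit_vec (2 * g) (2 * k + 1)"
    proof (rule eq_vecI)
      fix r assume "r < dim_vec (unit_vec (2 * g) (2 * k + 1) :: bit vec)"
      then have r: "r < 2 * g" by simp
      consider "r < 2 * k" | "r = 2 * k" | "r = 2 * k + 1" | "2 * k + 2 \<le> r" by linarith
      then show "w $ r = unit_vec (2 * g) (2 * k + 1) $ r"
        using r k odd1 low even0 high by cases auto
    qed (use w in auto)
    then have "1\<^sub>m (2 * g) *\<^sub>v w = unit_vec (2 * g) (2 * k + 1)" by simp
    then show ?thesis using generated.one by fastforce
  next
    case False
    then obtain j where j: "2 * k + 2 \<le> j" "j < 2 * g" "w $ j = 1" by (auto simp: S_def)
    define E where "E = siegel_mat g (2 * k) j"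
    have k2: "2 * k < 2 * g" using k by simp
    \<comment> \<open>The partner of \<open>j\<close> lies above the pair \<open>k\<close>, so \<open>E\<close> fixes the basis vectors up to index \<open>2k\<close>.\<close>
    have pj: "partner j \<ge> 2 * k + 2" using j(1) unfolding partner_def by presburger
    have E: "E \<in> generated g"
      unfolding E_def using j k by (intro siegel_mat_generated) auto
    note C = generated_carrier[OF E]
    have w': "E *\<^sub>v w \<in> carrier_vec (2 * g)" using C w by (rule mult_mat_vec_carrier)
    have act: "(E *\<^sub>v x) $ r = x $ r + (if r = j then x $ (2 * k + 1) else 0) +
        (if r = 2 * k then x $ partner j else 0)"
      if "x \<in> carrier_vec (2 * g)" "r < 2 * g" for x r
      using siegel_mat_action[OF k2 j(2) that] by (simp add: E_def)
    have at_j: "(E *\<^sub>v w) $ j = 0" using act[OF w j(2)] j odd1 by simp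
    have above: "(E *\<^sub>v w) $ r = w $ r" if "2 * k + 2 \<le> r" "r < 2 * g" "r \<noteq> j" for r
      using act[OF w that(2)] that by simp
    have "S (E *\<^sub>v w) \<subseteq> S w"
    proof
      fix r assume "r \<in> S (E *\<^sub>v w)"
      then have r: "2 * k + 2 \<le> r" "r < 2 * g" "(E *\<^sub>v w) $ r = 1" by (simp_all add: S_def)
      then have "r \<noteq> j" using at_j by force
      then show "r \<in> S w" using r above[of r] by (simp add: S_def)
    qed
    moreover have "j \<in> S w" "j \<notin> S (E *\<^sub>v w)" using j at_j by (simp_all add: S_def)
    ultimately have "S (E *\<^sub>v w) \<subset> S w" by blast
    then have "card (S (E *\<^sub>v w)) < card (S w)" using fin by (intro psubset_card_mono)
    moreover have "(E *\<^sub>v w) $ (2 * k + 1) = 1" using j k odd1 by (simp add: act[OF w])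
    moreover have "omega0 g (E *\<^sub>v w) = 0"
      using isometry_omega0[OF generated_isometry[OF E] w] less.prems(3) by simp
    moreover have "(E *\<^sub>v w) $ m = 0" if "m < 2 * k" for m
      using j k low[OF that] that by (simp add: act[OF w])
    ultimately obtain M where M: "M \<in> generated g"
        "M *\<^sub>v (E *\<^sub>v w) = unit_vec (2 * g) (2 * k + 1)"
        "\<And>m. m \<le> 2 * k \<Longrightarrow> M *\<^sub>v unit_vec (2 * g) m = unit_vec (2 * g) m"
      using less.hyps[of "E *\<^sub>v w"] w' unfolding S_def by blast
    have "E *\<^sub>v unit_vec (2 * g) m = unit_vec (2 * g) m" if "m \<le> 2 * k" for m
    proof (rule eq_vecI)
      fix r assume "r < dim_vec (unit_vec (2 * g) m :: bit vec)"
      then have "r < 2 * g" by simp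
      then show "(E *\<^sub>v unit_vec (2 * g) m) $ r = unit_vec (2 * g) m $ r"
        using that pj j k by (simp add: act)
    qed (use C in auto)
    then have "\<forall>m \<le> 2 * k. M * E *\<^sub>v unit_vec (2 * g) m = unit_vec (2 * g) m"
      using M(3) by (simp add: assoc_mult_mat_vec[OF generated_carrier[OF M(1)] C])
    moreover have "M * E *\<^sub>v w = unit_vec (2 * g) (2 * k + 1)"
      using M(2) by (simp add: assoc_mult_mat_vec[OF generated_carrier[OF M(1)] C w])
    ultimately show ?thesis using generated_mult[OF M(1) E] by blast
  qed
qed

text \<open>
  Exchanging the pair of \<open>i\<close> with the pair \<open>k\<close>, and flipping the pair \<open>k\<close> where necessary, brings the
  coordinate \<open>v $ i = 1\<close> to position \<open>2k+1\<close>. Clearing then gives the basis vector of index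
  \<open>2k+1\<close>, and one more flip turns its index into \<open>2k\<close>.
\<close>

lemma move_to_even_unit:
  assumes k: "k < g"
    and v: "v \<in> carrier_vec (2 * g)" "omega0 g v = 0" "\<And>m. m < 2 * k \<Longrightarrow> v $ m = 0"
    and i: "i < 2 * g" "v $ i = 1"
  shows "\<exists>M \<in> generated g. M *\<^sub>v v = unit_vec (2 * g) (2 * k) \<and>
    (\<forall>m < 2 * k. M *\<^sub>v unit_vec (2 * g) m = unit_vec (2 * g) m)"
proof -
  define movable where "movable v \<longleftrightarrow> (\<exists>M \<in> generated g. M *\<^sub>v v = unit_vec (2 * g) (2 * k) \<and>
    (\<forall>m < 2 * k. M *\<^sub>v unit_vec (2 * g) m = unit_vec (2 * g) m))" for v
  define good where "good v \<longleftrightarrow> v \<in> carrier_vec (2 * g) \<and> omega0 g v = 0 \<and> (\<forall>m < 2 * k. v $ m = 0)"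
    for v
  have fix_unit: "perm_mat g \<rho> *\<^sub>v unit_vec (2 * g) m = unit_vec (2 * g) m"
    if "pair_involution g \<rho>" "\<forall>m < 2 * k. \<rho> m = m" "m < 2 * k" for \<rho> m
    using perm_mat_unit[OF that(1), of m] that(2,3) k by simp
  have good_perm: "good (perm_mat g \<rho> *\<^sub>v v)"
    if "good v" "pair_involution g \<rho>" "\<forall>m < 2 * k. \<rho> m = m" for \<rho> v
    using that k mult_mat_vec_carrier[OF perm_mat_carrier, of v g \<rho>]
    by (auto simp: good_def perm_mat_action isometry_omega0[OF perm_mat_isometry])
  have movable_perm: "movable v"
    if \<rho>: "pair_involution g \<rho>" "\<forall>m < 2 * k. \<rho> m = m" and v: "good v"
      and mv: "movable (perm_mat g \<rho> *\<^sub>v v)" for \<rho> v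
  proof -
    obtain M where M: "M \<in> generated g" "M *\<^sub>v (perm_mat g \<rho> *\<^sub>v v) = unit_vec (2 * g) (2 * k)"
      "\<forall>m < 2 * k. M *\<^sub>v unit_vec (2 * g) m = unit_vec (2 * g) m"
      using mv by (auto simp: movable_def)
    note assoc = assoc_mult_mat_vec[OF generated_carrier[OF M(1)] perm_mat_carrier]
    have "M * perm_mat g \<rho> *\<^sub>v v = unit_vec (2 * g) (2 * k)"
      using M(2) v by (simp add: assoc good_def)
    moreover have "\<forall>m < 2 * k. M * perm_mat g \<rho> *\<^sub>v unit_vec (2 * g) m = unit_vec (2 * g) m"
      using M(3) by (simp add: assoc fix_unit[OF \<rho>])
    ultimately show ?thesis
      unfolding movable_def using generated_mult[OF M(1) generated_perm_mat[OF \<rho>(1)]] by blast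
  qed
  have flip: "\<forall>m < 2 * k. flip_pair k m = m" by (auto simp: flip_pair_def)
  have odd_case: "movable v" if v: "good v" "v $ (2 * k + 1) = 1" for v
  proof -
    obtain M where M: "M \<in> generated g" "M *\<^sub>v v = unit_vec (2 * g) (2 * k + 1)"
      "\<forall>m \<le> 2 * k. M *\<^sub>v unit_vec (2 * g) m = unit_vec (2 * g) m"
      using clear_to_odd_unit[OF k, of v] v by (auto simp: good_def)
    let ?F = "perm_mat g (flip_pair k)"
    have "?F *\<^sub>v unit_vec (2 * g) (2 * k + 1) = unit_vec (2 * g) (2 * k)"
      using perm_mat_unit[OF flip_pair_involution, of "2 * k + 1" g k] k by (simp add: flip_pair_def)
    then have "?F * M *\<^sub>v v = unit_vec (2 * g) (2 * k)"
      using M(2) v assoc_mult_mat_vec[OF perm_mat_carrier generated_carrier[OF M(1)], of v]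
      by (simp add: good_def)
    moreover have "\<forall>m < 2 * k. ?F * M *\<^sub>v unit_vec (2 * g) m = unit_vec (2 * g) m"
      using M(3) assoc_mult_mat_vec[OF perm_mat_carrier generated_carrier[OF M(1)]]
      by (simp add: fix_unit[OF flip_pair_involution flip])
    ultimately show ?thesis
      unfolding movable_def using generated.perm[OF flip_pair_involution M(1)] by blast
  qed
  have pair_case: "movable v" if v: "good v" "v $ i = 1" "i div 2 = k" for v i
  proof (cases "i = 2 * k + 1")
    case True
    then show ?thesis using odd_case v by simp
  next
    case False
    then have i: "i = 2 * k" using v(3) by presburger
    have "(perm_mat g (flip_pair k) *\<^sub>v v) $ (2 * k + 1) = v $ i"
      using perm_mat_action[OF flip_pair_involution, of v g "2 * k + 1" k] v(1) k i
      by (simp add: good_def flip_pair_def)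
    then show ?thesis
      using movable_perm[OF flip_pair_involution flip v(1)]
        odd_case[OF good_perm[OF v(1) flip_pair_involution flip]] v(2) by simp
  qed
  define \<sigma> where "\<sigma> = swap_pairs k (i div 2)"
  have \<sigma>: "pair_involution g \<sigma>"
    using k i unfolding \<sigma>_def by (intro swap_pairs_involution) auto
  have "\<not> i < 2 * k" using v(3) i(2) by auto
  then have "k \<le> i div 2" by linarith
  moreover have "m div 2 < k" if "m < 2 * k" for m using that by linarith
  ultimately have fixed: "\<forall>m < 2 * k. \<sigma> m = m" by (force simp: \<sigma>_def swap_pairs_def)
  have gv: "good v" using v by (simp add: good_def)
  have "(perm_mat g \<sigma> *\<^sub>v v) $ \<sigma> i = 1"
    using perm_mat_action[OF \<sigma> v(1), of "\<sigma> i"] pair_involutionD[OF \<sigma> i(1)] i(2) by simp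
  moreover have "\<sigma> i div 2 = k" by (simp add: \<sigma>_def swap_pairs_def)
  ultimately have "movable (perm_mat g \<sigma> *\<^sub>v v)"
    by (intro pair_case[OF good_perm[OF gv \<sigma> fixed]])
  then show ?thesis using movable_perm[OF \<sigma> fixed gv] by (simp add: movable_def)
qed

lemma omega0_unit: "m < 2 * g \<Longrightarrow> omega0 g (unit_vec (2 * g) m) = 0"
  unfolding omega0_def by (intro sum.neutral) auto

section \<open>Reduction of an isometry to the identity\<close>

text \<open>The coordinate at the partner of \<open>m\<close> is the product with \<open>e_m\<close>, so fixing \<open>e_m\<close> preserves that
  coordinate.\<close>

lemma isometry_coordinate:
  assumes A: "isometry g A" and m: "m < 2 * g" and l: "l < 2 * g"
    and fixed: "A *\<^sub>v unit_vec (2 * g) m = unit_vec (2 * g) m"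
  shows "(A *\<^sub>v unit_vec (2 * g) l) $ partner m = unit_vec (2 * g) l $ partner m"
  using isometry_symp_form[OF A, of "unit_vec (2 * g) l" "unit_vec (2 * g) m"]
  by (simp add: fixed symp_form_unit[OF m])

text \<open>Downward induction on the number \<open>k\<close> of hyperbolic pairs that are already fixed; fixing all
  \<open>g\<close> pairs leaves the identity.\<close>

lemma isometry_generated:
  assumes "isometry g A" and "k \<le> g"
    and "\<And>m. m < 2 * k \<Longrightarrow> A *\<^sub>v unit_vec (2 * g) m = unit_vec (2 * g) m"
  shows "A \<in> generated g"
  using assms(2,1,3)
proof (induction k arbitrary: A rule: inc_induct)
  case base
  have "A = 1\<^sub>m (2 * g)"
    using base by (intro mat_eqI_action[OF isometry_carrier]) auto
  then show ?case using generated.one by simp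
next
  case (step n)
  note A = step.prems(1) and C = isometry_carrier[OF step.prems(1)]
  define v where "v = A *\<^sub>v unit_vec (2 * g) (2 * n)"
  have n: "n < g" "2 * n < 2 * g" "2 * n + 1 < 2 * g" using step.hyps by auto
  have v: "v \<in> carrier_vec (2 * g)" using mult_mat_vec_carrier[OF C] by (simp add: v_def)
  have "omega0 g v = 0"
    using isometry_omega0[OF A] n by (simp add: v_def omega0_unit)
  moreover have "v $ m = 0" if "m < 2 * n" for m
  proof -
    have "partner m < 2 * n" using that by simp
    then show ?thesis
      using isometry_coordinate[OF A _ n(2) step.prems(2), of "partner m"] that n
      by (simp add: v_def)
  qed
  \<comment> \<open>The image of a basis vector cannot vanish, as it pairs to one with the image of its partner.\<close>
  moreover have "\<exists>i < 2 * g. v $ i = 1"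
  proof (rule ccontr)
    assume "\<not> ?thesis"
    then have "v $ i = 0" if "i < 2 * g" for i using that by auto
    then have "symp_form g v (A *\<^sub>v unit_vec (2 * g) (2 * n + 1)) = 0"
      unfolding symp_form_def by (intro sum.neutral) auto
    moreover have "symp_form g v (A *\<^sub>v unit_vec (2 * g) (2 * n + 1)) = 1"
      using isometry_symp_form[OF A, of "unit_vec (2 * g) (2 * n)" "unit_vec (2 * g) (2 * n + 1)"] n
      by (simp add: v_def symp_form_unit)
    ultimately show False by simp
  qed
  ultimately obtain M where M: "M \<in> generated g" "M *\<^sub>v v = unit_vec (2 * g) (2 * n)"
      "\<And>m. m < 2 * n \<Longrightarrow> M *\<^sub>v unit_vec (2 * g) m = unit_vec (2 * g) m"
    using move_to_even_unit[OF n(1) v] by blast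
  define A' where "A' = M * A"
  have A': "isometry g A'" unfolding A'_def by (rule isometry_mult[OF generated_isometry[OF M(1)] A])
  note C' = isometry_carrier[OF A']
  have fixed: "A' *\<^sub>v unit_vec (2 * g) m = unit_vec (2 * g) m" if "m \<le> 2 * n" for m
    using that M step.prems(2)[of m] assoc_mult_mat_vec[OF generated_carrier[OF M(1)] C]
    by (cases "m = 2 * n") (simp_all add: A'_def v_def)
  define w where "w = A' *\<^sub>v unit_vec (2 * g) (2 * n + 1)"
  have w: "w \<in> carrier_vec (2 * g)" using mult_mat_vec_carrier[OF C'] by (simp add: w_def)
  have "omega0 g w = 0"
    using isometry_omega0[OF A'] n by (simp add: w_def omega0_unit)
  moreover have "w $ (2 * n + 1) = 1"
    using isometry_coordinate[OF A' n(2) n(3) fixed] n by (simp add: w_def)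
  moreover have "w $ m = 0" if "m < 2 * n" for m
  proof -
    have "partner m < 2 * n" using that by simp
    then show ?thesis
      using isometry_coordinate[OF A' _ n(3) fixed[OF less_imp_le], of "partner m"] that n
      by (simp add: w_def)
  qed
  ultimately obtain N where N: "N \<in> generated g" "N *\<^sub>v w = unit_vec (2 * g) (2 * n + 1)"
      "\<And>m. m \<le> 2 * n \<Longrightarrow> N *\<^sub>v unit_vec (2 * g) m = unit_vec (2 * g) m"
    using clear_to_odd_unit[OF n(1) w] by blast
  have "N * A' *\<^sub>v unit_vec (2 * g) m = unit_vec (2 * g) m" if "m < 2 * Suc n" for m
  proof (cases "m = 2 * n + 1")
    case True
    then show ?thesis
      using N(2) assoc_mult_mat_vec[OF generated_carrier[OF N(1)] C'] by (simp add: w_def)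
  next
    case False
    then have "m \<le> 2 * n" using that by simp
    then show ?thesis
      using N(3) fixed assoc_mult_mat_vec[OF generated_carrier[OF N(1)] C'] by simp
  qed
  then have "N * A' \<in> generated g"
    by (intro step.IH isometry_mult[OF generated_isometry[OF N(1)] A'])
  then have "M * A \<in> generated g"
    unfolding A'_def[symmetric] by (rule generated_left_cancel[OF N(1) C'])
  then show ?case by (rule generated_left_cancel[OF M(1) C])
qed

lemma generated_mat_prod:
  assumes "A \<in> generated g"
  shows "\<exists>Bs. (\<forall>B \<in> set Bs. symplectic_permutation g B \<or> (g \<ge> 2 \<and> B = B1 g)) \<and>
    A = mat_prod (2*g) Bs"
  using assms
proof (induction rule: generated.induct)
  case one
  show ?case by (rule exI[of _ "[]"]) (simp add: mat_prod_def)
next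
  case (perm \<rho> M)
  then obtain Bs where "\<forall>B \<in> set Bs. symplectic_permutation g B \<or> (g \<ge> 2 \<and> B = B1 g)"
    "M = mat_prod (2*g) Bs" by blast
  then show ?case
    using perm_mat_symplectic_permutation[OF perm(1)]
    by (intro exI[of _ "perm_mat g \<rho> # Bs"]) (simp add: mat_prod_def)
next
  case (B1 M)
  then obtain Bs where "\<forall>B \<in> set Bs. symplectic_permutation g B \<or> (g \<ge> 2 \<and> B = B1 g)"
    "M = mat_prod (2*g) Bs" by blast
  then show ?case
    using B1(1) by (intro exI[of _ "B1 g # Bs"]) (simp add: mat_prod_def)
qed

theorem theorem19:
  fixes g :: nat and A :: "bit mat"
  assumes "g \<ge> 1" and "A \<in> Sp0 g"
  shows "\<exists>Bs. (\<forall>B \<in> set Bs. symplectic_permutation g B \<or> (g \<ge> 2 \<and> B = B1 g)) \<and>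
    A = mat_prod (2*g) Bs"
proof (rule generated_mat_prod)
  have "isometry g A"
    using assms(2) by (auto simp: Sp0_def Sp_def isometry_def)
  then show "A \<in> generated g"
    by (rule isometry_generated[where k = 0]) simp_all
qed

end
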